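(* Let $b$ be a prime, let $e\ge1$ and $s\ge1$, let $p\in\mathrm{GF}(b)[x]$ have degree $e$, and let $c_1,\dots,c_s\in\mathrm{GF}(b)$ be such that $p+c_1,\dots,p+c_s$ are pairwise distinct irreducible polynomials of degree $e$. For each $i\in\{1,\dots,s\}$ let $M^{(c_i)}$ be the Sobol' matrix of $p+c_i$ with some invertible upper triangular initialization matrix $M^{(c_i)}_{[e\times e]}$. Let $(x_n)_{n\ge0}$ be the $s$-dimensional digital sequence in base $b$ generated by $M^{(c_1)},\dots,M^{(c_s)}$. If for every $m\le s(e-1)$ the first $b^m$ points $x_0,\dots,x_{b^m-1}$ form a $(0,m,s)$-net in base $b$, then $(x_n)_{n\ge0}$ is a $(0,s)$-sequence in base $b$.
   Context: All matrices have entries in $\mathrm{GF}(b)=\mathbb{Z}/b\mathbb{Z}$, $b$ prime. Sobol' matrix (block recurrence). Let $p(x)=\sum_{i=0}^{e}a_ix^i$ be a polynomial of degree $e$ over $\mathrm{GF}(b)$. Let $Q_p$ be the $e\times e$ lower triangular Toeplitz matrix with $(u,v)$ entry $-a_{u-v}$ for $u\ge v$ and $0$ for $u<v$ ($1\le u,v\le e$). Let $F_p$ be the inverse of the $e\times e$ upper unitriangular Toeplitz matrix $F_p^{-1}$ whose $(u,v)$ entry is $1$ if $u=v$, $-a_{e-(v-u)}$ if $v>u$, and $0$ if $v<u$ (so the first row of $F_p^{-1}$ is $1,-a_{e-1},-a_{e-2},\dots,-a_1$). Given an invertible upper triangular $e\times e$ initialization matrix $M_{[e\times e]}$, the Sobol'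 matrix $M$ of $p$ is the infinite matrix with $e\times e$ blocks $M_{i,j}$, $i,j\ge1$, defined by $M_{i,1}=\delta_{i,1}M_{[e\times e]}$ and $$M_{i,j}=\left(M_{i,j-1}Q_p+M_{i-1,j-1}\right)F_p\qquad (i\ge1,\ j\ge2),$$ with $M_{0,j}=0$. The matrix $M$ is upper triangular with nonzero diagonal entries. For a shifted polynomial $p+c$, $c\in\mathrm{GF}(b)$, its Sobol' matrix is denoted $M^{(c)}$. Digital sequence. Given infinite upper triangular matrices $M_1,\dots,M_s$ over $\mathrm{GF}(b)$, the point $x_n\in[0,1)^s$ ($n\ge0$) is defined as follows: write $n=\sum_{k\ge0}n_kb^k$ with digits $n_k\in\{0,\dots,b-1\}$, let $\vec n=(n_0,n_1,\dots)^T$, compute $y^{(i)}=M_i\vec n$ over $\mathrm{GF}(b)$ (a vector with finitely many nonzero entries), and let the $i$-th coordinate of $x_n$ be $\sum_{k\ge1}y^{(i)}_kb^{-k}$, entries being identified with integers in $\{0,\dots,b-1\}$. Nets and sequences. A family of $b^m$ points in $[0,1)^s$ is a $(0,m,s)$-net in base $b$ if for all integers $d_1,\dots,d_s\ge0$ with $\sum_i d_i=m$, every box $\prod_{i=1}^s[A_ib^{-d_i},(A_i+1)b^{-d_i})$ with integers $0\le A_i<b^{d_i}$ contains exactly one of the points. A sequence $(x_n)_{n\ge0}$ in $[0,1)^s$ is a $(0,s)$-sequence in base $b$ if for all integers $k\ge0$, $m\ge 0$, the points $x_n$ with $kb^m\le n<(k+1)b^m$ form a $(0,m,s)$-net in base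 $b$. For the digital sequence $(x_n)_{n\ge0}$ in base $b$ generated by infinite upper triangular matrices $M_1,\dots,M_s$ over $\mathrm{GF}(b)$, it is standard that the first $b^m$ points form a $(0,m,s)$-net if and only if, for all $d_1,\dots,d_s\ge0$ with $\sum_id_i=m$, the $m\times m$ matrix obtained by stacking the first $d_i$ rows of the top-left $m\times m$ submatrix of $M_i$, $i=1,\dots,s$, is nonsingular; the sequence is a $(0,s)$-sequence if and only if this holds for all $m$. *)

theory Defs
  imports
    "Berlekamp_Zassenhaus.Finite_Field"
    "Jordan_Normal_Form.Determinant"
    "Jordan_Normal_Form.Gauss_Jordan_Elimination"
begin

text \<open>
  The field \<open>GF(b)\<close> is \<open>'a mod_ring\<close> with \<open>'a :: prime_card\<close> and \<open>b = CARD('a)\<close>.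
  All rows, columns, blocks and coordinates are numbered from \<open>0\<close>. In the Toeplitz matrices only
  differences of indices occur, so their formulas are those for numbering from \<open>1\<close>.
\<close>

definition sobol_Q :: "'a::field poly \<Rightarrow> 'a mat" where
  "sobol_Q p = mat (degree p) (degree p)
     (\<lambda>(u, v). if v \<le> u then - Polynomial.coeff p (u - v) else 0)"

definition sobol_F_inv :: "'a::field poly \<Rightarrow> 'a mat" where
  "sobol_F_inv p = mat (degree p) (degree p)
     (\<lambda>(u, v). if u = v then 1 else if u < v then - Polynomial.coeff p (degree p - (v - u)) else 0)"

definition sobol_F :: "'a::field poly \<Rightarrow> 'a mat" where
  "sobol_F p = the (mat_inverse (sobol_F_inv p))"

lemma sobol_F_inverse:
  fixes p :: "'a::field poly"
  shows "sobol_F p \<in> carrier_mat (degree p) (degree p)"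
    and "sobol_F_inv p * sobol_F p = 1\<^sub>m (degree p)"
    and "sobol_F p * sobol_F_inv p = 1\<^sub>m (degree p)"
proof -
  let ?e = "degree p" and ?A = "sobol_F_inv p"
  have A: "?A \<in> carrier_mat ?e ?e"
    by (simp add: sobol_F_inv_def)
  have "upper_triangular ?A"
    by (auto simp: sobol_F_inv_def)
  then have "det ?A = prod_list (diag_mat ?A)"
    using A by (rule det_upper_triangular)
  also have "diag_mat ?A = map (\<lambda>_. 1) [0..<?e]"
    by (auto simp: diag_mat_def sobol_F_inv_def)
  also have "prod_list \<dots> = (1 :: 'a)"
    by (intro prod_list_neutral) auto
  finally have "det ?A \<noteq> 0"
    by simp
  then have "?A \<in> Units (ring_mat TYPE('a) ?e ())"
    using A by (intro det_non_zero_imp_unit)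
  then obtain B where B: "mat_inverse ?A = Some B"
    using mat_inverse(1)[OF A, of "()"] by blast
  show "sobol_F p \<in> carrier_mat ?e ?e" "?A * sobol_F p = 1\<^sub>m ?e" "sobol_F p * ?A = 1\<^sub>m ?e"
    using mat_inverse(2)[OF A B] B by (simp_all add: sobol_F_def)
qed

text \<open>
  \<open>sobol_block p M0 i j\<close> is the block in block row \<open>i\<close> and block column \<open>j\<close>; the zero matrix in
  the last line is the block above the first block row.
\<close>

fun sobol_block :: "'a::field poly \<Rightarrow> 'a mat \<Rightarrow> nat \<Rightarrow> nat \<Rightarrow> 'a mat" where
  "sobol_block p M0 i 0 = (if i = 0 then M0 else 0\<^sub>m (degree p) (degree p))"
| "sobol_block p M0 i (Suc j) =
     (sobol_block p M0 i j * sobol_Q p +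
      (if i = 0 then 0\<^sub>m (degree p) (degree p) else sobol_block p M0 (i - 1) j)) * sobol_F p"

definition sobol_matrix :: "'a::field poly \<Rightarrow> 'a mat \<Rightarrow> nat \<Rightarrow> nat \<Rightarrow> 'a" where
  "sobol_matrix p M0 r k =
     sobol_block p M0 (r div degree p) (k div degree p) $$ (r mod degree p, k mod degree p)"

text \<open>
  Digit \<open>k\<close> of \<open>n\<close> in base \<open>b\<close> is \<open>n div b ^ k mod b\<close>; it vanishes when \<open>b ^ k > n\<close>, so the
  matrix-vector product below is the full one.
\<close>

definition digital_vec ::
    "(nat \<Rightarrow> nat \<Rightarrow> 'a::prime_card mod_ring) \<Rightarrow> nat \<Rightarrow> nat \<Rightarrow> 'a mod_ring" where
  "digital_vec M n r =
     (\<Sum>k | CARD('a) ^ k \<le> n. M r k * of_nat (n div CARD('a) ^ k mod CARD('a)))"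

definition digital_seq ::
    "(nat \<Rightarrow> nat \<Rightarrow> nat \<Rightarrow> 'a::prime_card mod_ring) \<Rightarrow> nat \<Rightarrow> nat \<Rightarrow> real" where
  "digital_seq M n i =
     (\<Sum>r. of_int (to_int_mod_ring (digital_vec (M i) n r)) / real CARD('a) ^ (r + 1))"

text \<open>
  A point of \<open>[0,1)\<^sup>s\<close> is a function on \<open>nat\<close> of which only the coordinates \<open>i < s\<close> matter.
  The points of a net form a family indexed by \<open>N\<close>, counted with multiplicity.
\<close>

definition is_net :: "nat \<Rightarrow> nat \<Rightarrow> nat \<Rightarrow> nat set \<Rightarrow> (nat \<Rightarrow> nat \<Rightarrow> real) \<Rightarrow> bool" where
  "is_net b m s N x \<longleftrightarrow>
     finite N \<and> card N = b ^ m \<and>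
     (\<forall>n\<in>N. \<forall>i<s. x n i \<in> {0..<1}) \<and>
     (\<forall>d A. (\<Sum>i<s. d i) = m \<longrightarrow> (\<forall>i<s. A i < b ^ d i) \<longrightarrow>
        (\<exists>!n. n \<in> N \<and>
           (\<forall>i<s. x n i \<in> {real (A i) / real b ^ d i ..< (real (A i) + 1) / real b ^ d i})))"

definition is_zero_sequence :: "nat \<Rightarrow> nat \<Rightarrow> (nat \<Rightarrow> nat \<Rightarrow> real) \<Rightarrow> bool" where
  "is_zero_sequence b s x \<longleftrightarrow> (\<forall>k m. is_net b m s {k * b ^ m ..< (k + 1) * b ^ m} x)"

end

theory Submission
  imports Defs
begin

text \<open>
  Let \<open>(G\<^sub>j)\<close> be the generating functions, over the block rows, of the block columns of the Sobol' matrix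
  of \<open>p\<close> with identity initialization. They form a triangular basis of the vector polynomials
  \<open>V\<close> filtered by degree, and since the Sobol' matrix of \<open>p + c\<close> arises from the substitution
  \<open>t \<mapsto> t - c\<close>, its \<open>i\<close>-th block row computes \<open>M0\<close> times the \<open>i\<close>-th Taylor coefficient of \<open>V\<close>
  at \<open>- c\<close>. The net property thus is unique solvability of a Hermite interpolation problem with
  \<open>d i\<close> scalar conditions at \<open>- c i\<close>. If \<open>d i \<ge> e\<close>, then \<open>V\<close> is divisible by \<open>t + c i\<close>, and the
  quotient solves the problem with \<open>d i\<close> lowered by \<open>e\<close>. Repeating this leads to all
  \<open>d i \<le> e - 1\<close>, hence to a total of at most \<open>s * (e - 1)\<close> conditions.
\<close>

section \<open>Radix expansions and elementary intervals\<close>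

definition radix_value :: "nat \<Rightarrow> (nat \<Rightarrow> int) \<Rightarrow> real" where
  "radix_value b y = (\<Sum>r. of_int (y r) / real b ^ (r + 1))"

text \<open>Expansions that end in the repeated digit \<open>b - 1\<close> are excluded, so the
  value stays below 1 and determines the digits.\<close>

definition finite_digits :: "nat \<Rightarrow> (nat \<Rightarrow> int) \<Rightarrow> bool" where
  "finite_digits b y \<longleftrightarrow> (\<forall>r. 0 \<le> y r \<and> y r < int b) \<and> (\<exists>L. \<forall>r\<ge>L. y r = 0)"

lemma finite_digits_Suc: "finite_digits b y \<Longrightarrow> finite_digits b (\<lambda>r. y (Suc r))"
  unfolding finite_digits_def by (meson le_Suc_eq)

lemma radix_value_eq_sum:
  assumes "\<And>r. r \<ge> L \<Longrightarrow> y r = 0"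
  shows "radix_value b y = (\<Sum>r<L. of_int (y r) / real b ^ (r + 1))"
  unfolding radix_value_def by (rule suminf_finite) (use assms in auto)

lemma radix_value_Suc:
  assumes y: "finite_digits b y" and b: "b > 0"
  shows "real b * radix_value b y = of_int (y 0) + radix_value b (\<lambda>r. y (Suc r))"
proof -
  obtain L where L: "\<And>r. r \<ge> L \<Longrightarrow> y r = 0"
    using y by (auto simp: finite_digits_def)
  have "radix_value b y = (\<Sum>r<Suc L. of_int (y r) / real b ^ (r + 1))"
    by (rule radix_value_eq_sum) (use L in auto)
  moreover have "radix_value b (\<lambda>r. y (Suc r)) = (\<Sum>r<L. of_int (y (Suc r)) / real b ^ (r + 1))"
    by (rule radix_value_eq_sum) (use L in auto)
  ultimately show ?thesis
    using b by (simp add: sum.lessThan_Suc_shift distrib_left sum_distrib_left del: sum.lessThan_Suc)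
qed

lemma radix_value_bounds:
  assumes y: "finite_digits b y" and b: "b > 0"
  shows "0 \<le> radix_value b y" "radix_value b y < 1"
proof -
  obtain L where L: "\<And>r. r \<ge> L \<Longrightarrow> y r = 0"
    using y by (auto simp: finite_digits_def)
  have dig: "0 \<le> y r" "y r \<le> int b - 1" for r
    using y by (auto simp: finite_digits_def)
  have eq: "radix_value b y = (\<Sum>r<L. of_int (y r) / real b ^ (r + 1))"
    by (rule radix_value_eq_sum) (use L in auto)
  show "0 \<le> radix_value b y"
    unfolding eq using dig by (intro sum_nonneg) auto
  \<comment> \<open>The bound is the value of \<open>L\<close> digits all equal to
    \<open>b - 1\<close>. In this form the induction telescopes.\<close>
  have "(\<Sum>r<L. of_int (y r) / real b ^ (r + 1)) \<le> 1 - 1 / real b ^ L"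
  proof (induction L)
    case (Suc L)
    have "real_of_int (y L) \<le> real b - 1"
      using dig(2)[of L] by linarith
    then have "of_int (y L) / real b ^ (L + 1) \<le> (real b - 1) / real b ^ (L + 1)"
      by (intro divide_right_mono) auto
    also have "\<dots> = 1 / real b ^ L - 1 / real b ^ Suc L"
      using b by (simp add: field_simps)
    finally show ?case
      using Suc by simp
  qed simp
  also have "\<dots> < 1"
    using b by simp
  finally show "radix_value b y < 1"
    unfolding eq .
qed

text \<open>Induction on \<open>d\<close> peels off the leading digit: scaling by
  \<open>b ^ Suc d\<close> gives \<open>b ^ d * y 0\<close> plus the scaled tail, whose floor lies
  in \<open>[0, b ^ d)\<close>. Division with remainder by \<open>b ^ d\<close> then compares the
  two parts separately.\<close>

lemma floor_radix_value_eq_iff: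
  assumes "finite_digits b y" "finite_digits b y'" and b: "b > 0"
  shows "\<lfloor>real b ^ d * radix_value b y\<rfloor> = \<lfloor>real b ^ d * radix_value b y'\<rfloor> \<longleftrightarrow> (\<forall>r<d. y r = y' r)"
  using assms(1,2)
proof (induction d arbitrary: y y')
  case 0
  have "\<lfloor>radix_value b z\<rfloor> = 0" if "finite_digits b z" for z
    using radix_value_bounds[OF that b] by (simp add: floor_eq_iff)
  with 0 show ?case
    by simp
next
  case (Suc d)
  have split: "\<lfloor>real b ^ Suc d * radix_value b z\<rfloor>
      = int b ^ d * z 0 + \<lfloor>real b ^ d * radix_value b (\<lambda>r. z (Suc r))\<rfloor>"
    and bounds: "0 \<le> \<lfloor>real b ^ d * radix_value b (\<lambda>r. z (Suc r))\<rfloor>"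
      "\<lfloor>real b ^ d * radix_value b (\<lambda>r. z (Suc r))\<rfloor> < int b ^ d"
    if z: "finite_digits b z" for z
  proof -
    have "real b ^ Suc d * radix_value b z = real b ^ d * (real b * radix_value b z)"
      by simp
    also have "\<dots> = of_int (int b ^ d * z 0) + real b ^ d * radix_value b (\<lambda>r. z (Suc r))"
      using radix_value_Suc[OF z b] by (simp add: algebra_simps)
    finally show "\<lfloor>real b ^ Suc d * radix_value b z\<rfloor>
        = int b ^ d * z 0 + \<lfloor>real b ^ d * radix_value b (\<lambda>r. z (Suc r))\<rfloor>"
      by (metis floor_add_int add.commute)
    note * = radix_value_bounds[OF finite_digits_Suc[OF z] b]
    show "0 \<le> \<lfloor>real b ^ d * radix_value b (\<lambda>r. z (Suc r))\<rfloor>"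
      using * by simp
    have "real b ^ d * radix_value b (\<lambda>r. z (Suc r)) < real b ^ d * 1"
      using * b by (intro mult_strict_left_mono) auto
    then show "\<lfloor>real b ^ d * radix_value b (\<lambda>r. z (Suc r))\<rfloor> < int b ^ d"
      by (simp add: floor_less_iff)
  qed
  have cancel: "B * q + f = B * q' + f' \<longleftrightarrow> q = q' \<and> f = f'"
    if "0 \<le> f" "f < B" "0 \<le> f'" "f' < B" for B q f q' f' :: int
  proof
    assume eq: "B * q + f = B * q' + f'"
    have "q = (B * q + f) div B" "q' = (B * q' + f') div B"
      using that by auto
    then show "q = q' \<and> f = f'"
      using eq by auto
  qed auto
  have "\<lfloor>real b ^ Suc d * radix_value b y\<rfloor> = \<lfloor>real b ^ Suc d * radix_value b y'\<rfloor> \<longleftrightarrow>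
      y 0 = y' 0 \<and> (\<forall>r<d. y (Suc r) = y' (Suc r))"
    unfolding split[OF Suc.prems(1)] split[OF Suc.prems(2)]
    using Suc.IH[OF Suc.prems[THEN finite_digits_Suc]]
    by (subst cancel) (use bounds Suc.prems in auto)
  also have "\<dots> \<longleftrightarrow> (\<forall>r<Suc d. y r = y' r)"
    by (auto simp: less_Suc_eq_0_disj)
  finally show ?case .
qed

lemma mem_elementary_interval_iff:
  assumes "b > (0 :: nat)"
  shows "t \<in> {real A / real b ^ d ..< (real A + 1) / real b ^ d} \<longleftrightarrow> \<lfloor>real b ^ d * t\<rfloor> = int A"
  using assms by (auto simp: floor_eq_iff field_simps)

section \<open>Digits of natural numbers\<close>

lemma mod_power_eq_if_digits_eq:
  fixes n n' b :: nat
  assumes "\<And>k. k < m \<Longrightarrow> n div b ^ k mod b = n' div b ^ k mod b"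
  shows "n mod b ^ m = n' mod b ^ m"
  using assms
proof (induction m)
  case (Suc m)
  then show ?case
    using mod_mult2_eq[of n "b ^ m" b] mod_mult2_eq[of n' "b ^ m" b] by (simp add: mult.commute)
qed simp

lemma ex_digits:
  fixes a :: "nat \<Rightarrow> nat"
  assumes "\<And>k. k < m \<Longrightarrow> a k < b"
  shows "\<exists>n < b ^ m. \<forall>k<m. n div b ^ k mod b = a k"
  using assms
proof (induction m arbitrary: a)
  case (Suc m)
  obtain n where n: "n < b ^ m" "\<And>k. k < m \<Longrightarrow> n div b ^ k mod b = a (Suc k)"
    using Suc.IH[of "\<lambda>k. a (Suc k)"] Suc.prems by auto
  have a0: "a 0 < b"
    using Suc.prems by simp
  have "b * n + a 0 < b * (n + 1)"
    using a0 by simp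
  also have "\<dots> \<le> b * b ^ m"
    using n(1) by (intro mult_left_mono) auto
  finally have "b * n + a 0 < b ^ Suc m"
    by simp
  moreover have "(b * n + a 0) div b ^ k mod b = a k" if "k < Suc m" for k
    using a0 n(2) that by (cases k) (auto simp: div_mult2_eq)
  ultimately show ?case
    by blast
qed simp

section \<open>Digital sequences: the net property as linear algebra\<close>

definition row_upper_triangular :: "(nat \<Rightarrow> nat \<Rightarrow> 'a::zero) \<Rightarrow> bool" where
  "row_upper_triangular M \<longleftrightarrow> (\<forall>r k. k < r \<longrightarrow> M r k = 0)"

lemma digital_vec_eq_sum:
  fixes M :: "nat \<Rightarrow> nat \<Rightarrow> 'a::prime_card mod_ring"
  assumes "n < CARD('a) ^ L"
  shows "digital_vec M n r = (\<Sum>k<L. M r k * of_nat (n div CARD('a) ^ k mod CARD('a)))"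
  unfolding digital_vec_def
proof (rule sum.mono_neutral_left)
  have "n < CARD('a) ^ k" if "L \<le> k" for k
    using assms power_increasing[OF that, of "CARD('a)"] by simp
  then show "{k. CARD('a) ^ k \<le> n} \<subseteq> {..<L}"
    by (auto simp flip: not_le)
qed auto

lemma one_less_CARD_prime_card: "1 < CARD('a::prime_card)"
  using prime_card by (rule prime_gt_1_nat)

lemma finite_digits_digital_vec:
  fixes M :: "nat \<Rightarrow> nat \<Rightarrow> 'a::prime_card mod_ring"
  assumes "row_upper_triangular M"
  shows "finite_digits CARD('a) (\<lambda>r. to_int_mod_ring (digital_vec M n r))"
proof -
  have "to_int_mod_ring z \<in> {0..<int CARD('a)}" for z :: "'a mod_ring"
    using range_to_int_mod_ring by blast
  moreover have "digital_vec M n r = 0" if "r \<ge> n" for r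
  proof -
    have "n < CARD('a) ^ n"
      using one_less_CARD_prime_card[where 'a='a] by (simp add: power_gt_expt)
    then show ?thesis
      using assms that by (auto simp: digital_vec_eq_sum row_upper_triangular_def intro!: sum.neutral)
  qed
  ultimately show ?thesis
    unfolding finite_digits_def by (auto intro!: exI[of _ n])
qed

text \<open>The stacked rows form a square matrix of size \<open>sum d {..<s}\<close>. Over a field,
  its trivial kernel amounts to nonsingularity, and stating it this way avoids assembling the
  matrix.\<close>

definition nondegenerate ::
    "(nat \<Rightarrow> nat \<Rightarrow> nat \<Rightarrow> 'a::semiring_0) \<Rightarrow> nat \<Rightarrow> (nat \<Rightarrow> nat) \<Rightarrow> bool" where
  "nondegenerate M s d \<longleftrightarrow>
     (\<forall>v. (\<forall>i<s. \<forall>r<d i. (\<Sum>k<sum d {..<s}. M i r k * v k) = 0) \<longrightarrow> (\<forall>k<sum d {..<s}. v k = 0))"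

lemma digital_seq_floor_eq_iff:
  fixes M :: "nat \<Rightarrow> nat \<Rightarrow> nat \<Rightarrow> 'a::prime_card mod_ring"
  assumes "row_upper_triangular (M i)"
  shows "\<lfloor>real CARD('a) ^ d * digital_seq M n i\<rfloor> = \<lfloor>real CARD('a) ^ d * digital_seq M n' i\<rfloor> \<longleftrightarrow>
    (\<forall>r<d. digital_vec (M i) n r = digital_vec (M i) n' r)"
  using floor_radix_value_eq_iff[OF finite_digits_digital_vec[of "M i" n, OF assms]
      finite_digits_digital_vec[of "M i" n', OF assms], of d]
  by (simp add: digital_seq_def radix_value_def)

lemma digital_seq_bounds:
  fixes M :: "nat \<Rightarrow> nat \<Rightarrow> nat \<Rightarrow> 'a::prime_card mod_ring"
  assumes "row_upper_triangular (M i)"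
  shows "digital_seq M n i \<in> {0..<1}"
  using radix_value_bounds[OF finite_digits_digital_vec[of "M i", OF assms]]
  by (simp add: digital_seq_def radix_value_def)

text \<open>A kernel vector is the digit vector of some \<open>n < b ^ m\<close>, with
  \<open>m\<close> the sum of \<open>d\<close>. The points with indices \<open>n\<close> and 0 then
  share the elementary box at the origin, which forces \<open>n = 0\<close>.\<close>

lemma nondegenerate_if_is_net:
  fixes M :: "nat \<Rightarrow> nat \<Rightarrow> nat \<Rightarrow> 'a::prime_card mod_ring"
  assumes upper: "\<And>i. i < s \<Longrightarrow> row_upper_triangular (M i)"
    and net: "is_net CARD('a) (sum d {..<s}) s {..<CARD('a) ^ sum d {..<s}} (digital_seq M)"
  shows "nondegenerate M s d"
  unfolding nondegenerate_def
proof (intro allI impI)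
  let ?b = "CARD('a)" and ?m = "sum d {..<s}"
  fix v :: "nat \<Rightarrow> 'a mod_ring" and k
  assume v: "\<forall>i<s. \<forall>r<d i. (\<Sum>k<?m. M i r k * v k) = 0" and k: "k < ?m"
  have "\<exists>a. \<forall>k. a k < ?b \<and> v k = of_nat (a k)"
    using surj_of_nat_mod_ring[where 'a='a] by (intro choice) auto
  then obtain a where a: "\<And>k. a k < ?b" "\<And>k. v k = of_nat (a k)"
    by auto
  obtain n where n: "n < ?b ^ ?m" "\<And>k. k < ?m \<Longrightarrow> n div ?b ^ k mod ?b = a k"
    using ex_digits[of ?m a ?b] a(1) by auto
  have zero: "digital_vec (M i) 0 r = 0" for i r
    by (simp add: digital_vec_def)
  have zero': "digital_seq M 0 i = 0" for i
    by (simp add: digital_seq_def zero)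
  have "digital_vec (M i) n r = digital_vec (M i) 0 r" if "i < s" "r < d i" for i r
    using v that by (simp add: zero digital_vec_eq_sum[OF n(1)] n(2) a(2))
  then have box: "digital_seq M n' i \<in> {real 0 / real ?b ^ d i ..< (real 0 + 1) / real ?b ^ d i}"
    if "i < s" "n' = n \<or> n' = 0" for i n'
    using that digital_seq_floor_eq_iff[of M i "d i" n 0, OF upper]
    by (subst mem_elementary_interval_iff) (auto simp: zero')
  have "\<exists>!n. n \<in> {..<?b ^ ?m} \<and>
      (\<forall>i<s. digital_seq M n i \<in> {real 0 / real ?b ^ d i ..< (real 0 + 1) / real ?b ^ d i})"
    using net[unfolded is_net_def, THEN conjunct2, THEN conjunct2, THEN conjunct2,
        THEN spec[where x = d], THEN spec[where x = "\<lambda>_. 0"]] by simp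
  moreover have "n' \<in> {..<?b ^ ?m} \<and>
      (\<forall>i<s. digital_seq M n' i \<in> {real 0 / real ?b ^ d i ..< (real 0 + 1) / real ?b ^ d i})"
    if "n' = n \<or> n' = 0" for n'
    using n(1) box that by auto
  ultimately have "n = 0"
    by blast
  then show "v k = 0"
    using n(2)[OF k] a(2)[of k] by simp
qed

text \<open>For fixed \<open>d\<close> there are as many boxes as points in the index block, so it
  suffices that no two points share a box. Two points in one box yield a difference of digit vectors
  in the kernel.\<close>

lemma is_net_if_nondegenerate:
  fixes M :: "nat \<Rightarrow> nat \<Rightarrow> nat \<Rightarrow> 'a::prime_card mod_ring"
  assumes upper: "\<And>i. i < s \<Longrightarrow> row_upper_triangular (M i)"
    and nondeg: "\<And>d. sum d {..<s} = m \<Longrightarrow> nondegenerate M s d"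
  shows "is_net CARD('a) m s {\<kappa> * CARD('a) ^ m ..< (\<kappa> + 1) * CARD('a) ^ m} (digital_seq M)"
  unfolding is_net_def
proof (intro conjI allI impI ballI)
  let ?b = "CARD('a)" let ?N = "{\<kappa> * ?b ^ m ..< (\<kappa> + 1) * ?b ^ m}"
  show "finite ?N" "card ?N = ?b ^ m"
    by auto
  show "digital_seq M n i \<in> {0..<1}" if "i < s" for n i
    using digital_seq_bounds[where M = M, OF upper[OF that]] .
  fix d A
  assume d: "sum d {..<s} = m" and A: "\<forall>i<s. A i < ?b ^ d i"
  \<comment> \<open>This is the index of the box containing point \<open>n\<close>. Restricting it
    to \<open>{..<s}\<close> makes it an element of the finite product \<open>PiE\<close>, which can
    be counted.\<close>
  define \<Phi> where "\<Phi> n = restrict (\<lambda>i. nat \<lfloor>real ?b ^ d i * digital_seq M n i\<rfloor>) {..<s}" for n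
  let ?B = "PiE {..<s} (\<lambda>i. {..<?b ^ d i})"
  have nonneg: "0 \<le> \<lfloor>real ?b ^ d i * digital_seq M n i\<rfloor>" if "i < s" for i n
    using digital_seq_bounds[where M = M and n = n, OF upper[OF that]] by simp
  have less: "\<lfloor>real ?b ^ d i * digital_seq M n i\<rfloor> < int (?b ^ d i)" if "i < s" for i n
  proof -
    have "real ?b ^ d i * digital_seq M n i < real ?b ^ d i * 1"
      using digital_seq_bounds[where M = M and n = n, OF upper[OF that]] by (intro mult_strict_left_mono) auto
    then show ?thesis
      by (simp add: floor_less_iff)
  qed
  have div: "n div ?b ^ m = \<kappa>" if "n \<in> ?N" for n
    using that by (intro div_nat_eqI) (auto simp: algebra_simps)
  have "inj_on \<Phi> ?N"
  proof (rule inj_onI)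
    fix n n' assume n: "n \<in> ?N" and n': "n' \<in> ?N" and eq: "\<Phi> n = \<Phi> n'"
    define v :: "nat \<Rightarrow> 'a mod_ring"
      where "v k = of_nat (n div ?b ^ k mod ?b) - of_nat (n' div ?b ^ k mod ?b)" for k
    \<comment> \<open>Digits from position \<open>m\<close> on are those of
      \<open>n div b ^ m\<close>, which is \<kappa> throughout the block.\<close>
    have high: "v k = 0" if "k \<ge> m" for k
    proof -
      have "l div ?b ^ k = l div ?b ^ m div ?b ^ (k - m)" for l :: nat
        using that by (simp add: div_mult2_eq[symmetric] power_add[symmetric])
      then show ?thesis
        unfolding v_def by (simp add: div[OF n] div[OF n'])
    qed
    have "(\<Sum>k<m. M i r k * v k) = 0" if i: "i < s" and r: "r < d i" for i r
    proof -
      have "nat \<lfloor>real ?b ^ d i * digital_seq M n i\<rfloor> = nat \<lfloor>real ?b ^ d i * digital_seq M n' i\<rfloor>"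
        using fun_cong[OF eq, of i] i by (simp add: \<Phi>_def)
      then have "digital_vec (M i) n r = digital_vec (M i) n' r"
        using digital_seq_floor_eq_iff[of M i "d i" n n', OF upper[OF i]] eq_nat_nat_iff[OF nonneg nonneg] i r
        by blast
      \<comment> \<open>The length \<open>m + n + n'\<close> accommodates all digits of both
        indices, so both matrix-vector products become sums over one range.\<close>
      moreover have "l < ?b ^ (m + n + n')" if "l \<le> m + n + n'" for l
        using power_gt_expt[of "CARD('a)" "m + n + n'"] one_less_CARD_prime_card[where 'a='a] that by simp
      ultimately have "(\<Sum>k<m + n + n'. M i r k * v k) = 0"
        by (simp add: digital_vec_eq_sum[where L = "m + n + n'"] v_def algebra_simps sum_subtractf)
      moreover have "(\<Sum>k<m. M i r k * v k) = (\<Sum>k<m + n + n'. M i r k * v k)"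
        using high by (intro sum.mono_neutral_left) auto
      ultimately show ?thesis
        by simp
    qed
    then have v0: "v k = 0" if "k < m" for k
      using nondeg[OF d] that unfolding nondegenerate_def d by blast
    have "n div ?b ^ k mod ?b = n' div ?b ^ k mod ?b" if "k < m" for k
    proof -
      \<comment> \<open>Reduction modulo \<open>b\<close> is injective on digits.\<close>
      have "of_nat (n div ?b ^ k mod ?b) = (of_nat (n' div ?b ^ k mod ?b) :: 'a mod_ring)"
        using v0[OF that] by (simp add: v_def)
      then have "of_int_mod_ring (int (n div ?b ^ k mod ?b)) =
          (of_int_mod_ring (int (n' div ?b ^ k mod ?b)) :: 'a mod_ring)"
        by (simp add: of_nat_of_int_mod_ring)
      then have "int (n div ?b ^ k mod ?b) = int (n' div ?b ^ k mod ?b)"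
        by (metis to_int_mod_ring_of_int_mod_ring of_nat_0_le_iff of_nat_less_iff mod_less_divisor
            zero_less_card_finite)
      then show ?thesis
        by (simp only: of_nat_eq_iff)
    qed
    then have "n mod ?b ^ m = n' mod ?b ^ m"
      by (rule mod_power_eq_if_digits_eq)
    with div[OF n] div[OF n'] show "n = n'"
      by (metis div_mult_mod_eq)
  qed
  moreover have "\<Phi> ` ?N \<subseteq> ?B"
    using nonneg less by (simp add: \<Phi>_def image_subset_iff restrict_PiE_iff nat_less_iff)
  moreover have "card ?B = ?b ^ m"
    by (simp add: card_PiE power_sum[symmetric] d)
  moreover have "finite ?B"
    by (intro finite_PiE) auto
  ultimately have bij: "bij_betw \<Phi> ?N ?B"
    by (metis (no_types, lifting) \<open>card ?N = ?b ^ m\<close> bij_betw_def card_image card_subset_eq)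
  have mem: "(\<forall>i<s. digital_seq M n i \<in> {real (A i) / real ?b ^ d i ..< (real (A i) + 1) / real ?b ^ d i})
      \<longleftrightarrow> \<Phi> n = restrict A {..<s}" for n
    using nonneg
    by (subst mem_elementary_interval_iff) (auto simp: \<Phi>_def restrict_def fun_eq_iff nat_eq_iff)
  have "restrict A {..<s} \<in> ?B"
    using A by auto
  then obtain n where n: "n \<in> ?N" "\<Phi> n = restrict A {..<s}"
    using bij_betw_imp_surj_on[OF bij] by (metis imageE)
  have "\<exists>!n. n \<in> ?N \<and> \<Phi> n = restrict A {..<s}"
  proof (rule ex1I[of _ n])
    fix l assume "l \<in> ?N \<and> \<Phi> l = restrict A {..<s}"
    then show "l = n"
      by (intro inj_onD[OF bij_betw_imp_inj_on[OF bij]]) (use n in simp_all)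
  qed (use n in simp)
  then show "\<exists>!n. n \<in> ?N \<and>
      (\<forall>i<s. digital_seq M n i \<in> {real (A i) / real ?b ^ d i ..< (real (A i) + 1) / real ?b ^ d i})"
    unfolding mem .
qed

section \<open>Triangular structure of the Sobol' matrix\<close>

text \<open>Back substitution from the last row upwards. In row \<open>u\<close> of
  \<open>sobol_F_inv p * sobol_F p\<close>, the left factor vanishes before column \<open>u\<close>,
  and by induction column \<open>v\<close> of the right factor vanishes below row \<open>u\<close>,
  so one product remains.\<close>

lemma sobol_F_upper:
  fixes p :: "'a::field poly"
  assumes "v \<le> u" "u < degree p"
  shows "sobol_F p $$ (u, v) = (if u = v then 1 else 0)"
  using assms
proof (induction "degree p - u" arbitrary: u rule: less_induct)
  case less
  let ?e = "degree p" and ?F = "sobol_F p" and ?A = "sobol_F_inv p"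
  have A: "?A $$ (u, u) = 1" "\<And>w. w < u \<Longrightarrow> ?A $$ (u, w) = 0" "?A \<in> carrier_mat ?e ?e"
    using less.prems by (auto simp: sobol_F_inv_def)
  have "(if u = v then 1 else 0) = (?A * ?F) $$ (u, v)"
    using less.prems by (simp add: sobol_F_inverse)
  also have "\<dots> = (\<Sum>w = 0..<?e. ?A $$ (u, w) * ?F $$ (w, v))"
    using less.prems A(3) sobol_F_inverse(1)[of p] by (simp add: scalar_prod_def)
  also have "\<dots> = (\<Sum>w\<in>{u}. ?A $$ (u, w) * ?F $$ (w, v))"
  proof (rule sum.mono_neutral_right; (intro ballI)?)
    fix w assume w: "w \<in> {0..<?e} - {u}"
    show "?A $$ (u, w) * ?F $$ (w, v) = 0"
    proof (cases "w < u")
      case False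
      then have "?F $$ (w, v) = 0"
        using less.hyps[of w] less.prems w by auto
      then show ?thesis
        by simp
    qed (simp add: A)
  qed (use less.prems in auto)
  finally show ?case
    by (simp add: A)
qed

lemma sobol_block_carrier:
  assumes "M0 \<in> carrier_mat (degree p) (degree p)"
  shows "sobol_block p M0 i j \<in> carrier_mat (degree p) (degree p)"
  using assms sobol_F_inverse(1)[of p]
  by (induction j arbitrary: i) (auto simp: sobol_Q_def intro!: mult_carrier_mat add_carrier_mat)

lemma sobol_block_Suc_entry:
  fixes p :: "'a::field poly"
  assumes M0: "M0 \<in> carrier_mat (degree p) (degree p)" and "a < degree p" "v < degree p"
  shows "sobol_block p M0 i (Suc j) $$ (a, v) =
    (\<Sum>w<degree p. ((\<Sum>u<degree p. sobol_block p M0 i j $$ (a, u) * sobol_Q p $$ (u, w)) +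
       (if i = 0 then 0 else sobol_block p M0 (i - 1) j $$ (a, w))) * sobol_F p $$ (w, v))"
proof -
  let ?e = "degree p" and ?B = "sobol_block p M0"
  have Q: "sobol_Q p \<in> carrier_mat ?e ?e"
    by (simp add: sobol_Q_def)
  define X where "X = (if i = 0 then 0\<^sub>m ?e ?e else ?B (i - 1) j)"
  have X: "X \<in> carrier_mat ?e ?e"
    by (simp add: X_def sobol_block_carrier[OF M0])
  have BQ: "?B i j * sobol_Q p \<in> carrier_mat ?e ?e"
    using Q sobol_block_carrier[OF M0] by (rule mult_carrier_mat[rotated])
  have "(?B i j * sobol_Q p + X) $$ (a, w) = (\<Sum>u<?e. ?B i j $$ (a, u) * sobol_Q p $$ (u, w)) +
       (if i = 0 then 0 else ?B (i - 1) j $$ (a, w))" if "w < ?e" for w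
  proof -
    have "(?B i j * sobol_Q p) $$ (a, w) = (\<Sum>u<?e. ?B i j $$ (a, u) * sobol_Q p $$ (u, w))"
      using Q sobol_block_carrier[OF M0, of i j] assms that
      by (simp add: scalar_prod_def atLeast0LessThan)
    moreover have "X $$ (a, w) = (if i = 0 then 0 else ?B (i - 1) j $$ (a, w))"
      using assms that by (simp add: X_def)
    ultimately show ?thesis
      using X that assms by simp
  qed
  moreover have "?B i (Suc j) $$ (a, v) =
      (\<Sum>w<?e. (?B i j * sobol_Q p + X) $$ (a, w) * sobol_F p $$ (w, v))"
    using add_carrier_mat[OF X, of "?B i j * sobol_Q p"] sobol_F_inverse(1)[of p] assms
    by (simp add: X_def[symmetric] scalar_prod_def atLeast0LessThan del: index_add_mat)
  ultimately show ?thesis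
    by simp
qed

lemma sobol_block_below_diagonal:
  fixes p :: "'a::field poly"
  assumes M0: "M0 \<in> carrier_mat (degree p) (degree p)" and "j < i" "a < degree p" "v < degree p"
  shows "sobol_block p M0 i j $$ (a, v) = 0"
  using assms(2-)
proof (induction j arbitrary: i v)
  case (Suc j)
  then show ?case
    by (subst sobol_block_Suc_entry[OF M0]) (auto intro!: sum.neutral)
qed simp

text \<open>The term with \<open>sobol_Q p\<close> drops out, since block \<open>(Suc j, j)\<close>
  lies below the block diagonal. The diagonal blocks are therefore \<open>M0\<close> times powers of
  \<open>sobol_F p\<close> and inherit its triangular shape.\<close>

lemma sobol_block_diagonal_Suc:
  fixes p :: "'a::field poly"
  assumes M0: "M0 \<in> carrier_mat (degree p) (degree p)" and "a < degree p" "v < degree p"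
  shows "sobol_block p M0 (Suc j) (Suc j) $$ (a, v) =
    (\<Sum>w<degree p. sobol_block p M0 j j $$ (a, w) * sobol_F p $$ (w, v))"
  using assms by (subst sobol_block_Suc_entry[OF M0]) (simp_all add: sobol_block_below_diagonal[OF M0])

lemma sobol_block_diagonal_lower:
  fixes p :: "'a::field poly"
  assumes M0: "M0 \<in> carrier_mat (degree p) (degree p)" "upper_triangular M0"
    and "v < a" "a < degree p"
  shows "sobol_block p M0 j j $$ (a, v) = 0"
  using assms(3-)
proof (induction j arbitrary: v)
  case 0
  then show ?case
    using M0 by auto
next
  case (Suc j)
  have "sobol_block p M0 j j $$ (a, w) * sobol_F p $$ (w, v) = 0" if "w < degree p" for w
    using Suc sobol_F_upper[of v w p] that by (cases "w < a") auto
  then show ?case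
    using Suc.prems by (subst sobol_block_diagonal_Suc[OF M0(1)]) (auto intro!: sum.neutral)
qed

lemma sobol_block_diagonal_one:
  fixes p :: "'a::field poly"
  assumes "a < degree p"
  shows "sobol_block p (1\<^sub>m (degree p)) j j $$ (a, a) = 1"
proof (induction j)
  case (Suc j)
  let ?B = "sobol_block p (1\<^sub>m (degree p))"
  have one: "1\<^sub>m (degree p) \<in> carrier_mat (degree p) (degree p)" "upper_triangular (1\<^sub>m (degree p) :: 'a mat)"
    by auto
  have "(\<Sum>w<degree p. ?B j j $$ (a, w) * sobol_F p $$ (w, a))
      = (\<Sum>w\<in>{a}. ?B j j $$ (a, w) * sobol_F p $$ (w, a))"
  proof (rule sum.mono_neutral_right; (intro ballI)?)
    fix w assume w: "w \<in> {..<degree p} - {a}"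
    show "?B j j $$ (a, w) * sobol_F p $$ (w, a) = 0"
    proof (cases "w < a")
      case True
      then show ?thesis
        using sobol_block_diagonal_lower[OF one True assms] by simp
    next
      case False
      then show ?thesis
        using sobol_F_upper[of a w p] w by simp
    qed
  qed (use assms in auto)
  then show ?case
    using Suc assms sobol_F_upper[of a a p] by (simp add: sobol_block_diagonal_Suc[OF one(1)] del: sobol_block.simps)
qed (use assms in simp)

lemma row_upper_triangular_sobol_matrix:
  fixes p :: "'a::field poly"
  assumes "degree p > 0" "M0 \<in> carrier_mat (degree p) (degree p)" "upper_triangular M0"
  shows "row_upper_triangular (sobol_matrix p M0)"
  unfolding row_upper_triangular_def
proof (intro allI impI)
  fix r k :: nat assume "k < r"
  let ?e = "degree p"
  consider "k div ?e < r div ?e" | "k div ?e = r div ?e" "k mod ?e < r mod ?e"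
    using \<open>k < r\<close> by (metis div_le_mono div_mult_mod_eq le_neq_implies_less less_or_eq_imp_le nat_add_left_cancel_less)
  then show "sobol_matrix p M0 r k = 0"
    unfolding sobol_matrix_def
    by cases (use assms in \<open>auto simp: sobol_block_below_diagonal sobol_block_diagonal_lower\<close>)
qed

section \<open>Generating functions of the block columns\<close>

text \<open>The generating function, in the block row index, of the entries at place
  \<open>(a, v)\<close> in block column \<open>j\<close>. It may stop at \<open>j\<close> because
  the blocks below the diagonal are zero.\<close>

definition sobol_poly :: "'a::field poly \<Rightarrow> 'a mat \<Rightarrow> nat \<Rightarrow> nat \<Rightarrow> nat \<Rightarrow> 'a poly" where
  "sobol_poly p M0 j a v = (\<Sum>i\<le>j. Polynomial.monom (sobol_block p M0 i j $$ (a, v)) i)"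

lemma coeff_sobol_poly:
  fixes p :: "'a::field poly"
  assumes "M0 \<in> carrier_mat (degree p) (degree p)" "a < degree p" "v < degree p"
  shows "Polynomial.coeff (sobol_poly p M0 j a v) i = sobol_block p M0 i j $$ (a, v)"
proof -
  have "Polynomial.coeff (sobol_poly p M0 j a v) i = (if i \<le> j then sobol_block p M0 i j $$ (a, v) else 0)"
    by (simp add: sobol_poly_def coeff_sum if_distrib[of "\<lambda>x. x = _"] sum.delta cong: if_cong)
  then show ?thesis
    using sobol_block_below_diagonal[OF assms(1) _ assms(2,3)] by simp
qed

lemma sobol_poly_0: "sobol_poly p M0 0 a v = [:M0 $$ (a, v):]"
  by (simp add: sobol_poly_def monom_0)

text \<open>Passing from block row \<open>i - 1\<close> to \<open>i\<close> is multiplication by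
  \<open>t\<close>, so the block recurrence becomes
  \<open>G_(j+1) = G_j (Q + t I) F\<close>.\<close>

lemma sobol_poly_Suc:
  fixes p :: "'a::field poly"
  assumes M0: "M0 \<in> carrier_mat (degree p) (degree p)" and "a < degree p" "v < degree p"
  shows "sobol_poly p M0 (Suc j) a v =
    (\<Sum>w<degree p. smult (sobol_F p $$ (w, v))
      ((\<Sum>u<degree p. smult (sobol_Q p $$ (u, w)) (sobol_poly p M0 j a u)) + [:0, 1:] * sobol_poly p M0 j a w))"
proof (rule poly_eqI)
  fix i
  show "Polynomial.coeff (sobol_poly p M0 (Suc j) a v) i = Polynomial.coeff (\<Sum>w<degree p. smult (sobol_F p $$ (w, v))
      ((\<Sum>u<degree p. smult (sobol_Q p $$ (u, w)) (sobol_poly p M0 j a u)) + [:0, 1:] * sobol_poly p M0 j a w)) i"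
    using assms
    by (auto simp: coeff_sum coeff_sobol_poly[OF M0] sobol_block_Suc_entry[OF M0] coeff_pCons mult.commute
        simp del: sobol_block.simps intro!: sum.cong split: nat.split)
qed

text \<open>A shift of \<open>p\<close> by a constant leaves \<open>F\<close> unchanged and subtracts a scalar matrix from
  \<open>Q\<close>, which substitutes \<open>t - c\<close> for the variable \<open>t\<close> of the row generating functions.\<close>

lemma sobol_poly_shift:
  fixes p :: "'a::field poly"
  assumes e: "degree p > 0" and M0: "M0 \<in> carrier_mat (degree p) (degree p)"
    and a: "a < degree p" and v: "v < degree p"
  shows "sobol_poly (p + [:c:]) M0 j a v =
    (\<Sum>u<degree p. smult (M0 $$ (a, u)) (pcompose (sobol_poly p (1\<^sub>m (degree p)) j u v) [:-c, 1:]))"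
  using v
proof (induction j arbitrary: v)
  case 0
  then have "(\<Sum>u<degree p. smult (M0 $$ (a, u)) (pcompose (sobol_poly p (1\<^sub>m (degree p)) 0 u v) [:-c, 1:])) =
      (\<Sum>u<degree p. if u = v then [:M0 $$ (a, v):] else 0)"
    by (intro sum.cong) (auto simp: sobol_poly_0)
  also have "\<dots> = [:M0 $$ (a, v):]"
    using 0 by simp
  finally show ?case
    by (simp add: sobol_poly_0)
next
  case (Suc j)
  let ?e = "degree p" and ?q = "p + [:c:]" and ?T = "\<lambda>f. pcompose f [:-c, 1:]"
  let ?G = "sobol_poly p (1\<^sub>m (degree p)) j"
  have deg: "degree ?q = ?e"
    using e by (intro degree_add_eq_left) simp
  \<comment> \<open>Above the diagonal only coefficients with index
    \<open>degree p - (v - u) > 0\<close> occur, so the constant term never enters.\<close>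
  have F: "sobol_F ?q = sobol_F p"
  proof -
    have "sobol_F_inv ?q = sobol_F_inv p"
      by (rule eq_matI) (auto simp: sobol_F_inv_def deg coeff_pCons split: nat.split)
    then show ?thesis
      by (simp add: sobol_F_def)
  qed
  have Q: "sobol_Q ?q $$ (u, w) = sobol_Q p $$ (u, w) - (if u = w then c else 0)" if "u < ?e" "w < ?e" for u w
    using that by (auto simp: sobol_Q_def deg coeff_pCons split: nat.split)
  have one: "1\<^sub>m ?e \<in> carrier_mat ?e ?e"
    by simp
  \<comment> \<open>The scalar subtracted from \<open>Q\<close> is moved over to \<open>t\<close>:
    \<open>(Q - c I) + t I = Q + (t - c) I\<close>.\<close>
  have step: "(\<Sum>u<?e. smult (sobol_Q ?q $$ (u, w)) (X u)) + [:0, 1:] * X w =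
      (\<Sum>u<?e. smult (sobol_Q p $$ (u, w)) (X u)) + [:-c, 1:] * X w" if "w < ?e" for X w
  proof -
    have "(\<Sum>u<?e. smult (sobol_Q ?q $$ (u, w)) (X u)) =
      (\<Sum>u<?e. smult (sobol_Q p $$ (u, w)) (X u) - (if u = w then smult c (X u) else 0))"
      using that by (intro sum.cong) (auto simp: Q smult_diff_left)
    also have "\<dots> = (\<Sum>u<?e. smult (sobol_Q p $$ (u, w)) (X u)) - smult c (X w)"
      using that by (simp add: sum_subtractf)
    finally show ?thesis
      by simp
  qed
  have "sobol_poly ?q M0 (Suc j) a v = (\<Sum>w<?e. smult (sobol_F p $$ (w, v))
      ((\<Sum>u<?e. smult (sobol_Q p $$ (u, w)) (sobol_poly ?q M0 j a u)) + [:-c, 1:] * sobol_poly ?q M0 j a w))"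
  proof -
    have "M0 \<in> carrier_mat (degree ?q) (degree ?q)" "a < degree ?q" "v < degree ?q"
      using M0 a Suc.prems by (simp_all only: deg)
    note sobol_poly_Suc[OF this, of j]
    then show ?thesis
      unfolding deg F by (rule trans) (intro sum.cong refl arg_cong2[where f = smult] step, simp)
  qed
  also have "\<dots> = (\<Sum>w<?e. smult (sobol_F p $$ (w, v))
      ((\<Sum>u<?e. smult (sobol_Q p $$ (u, w)) (\<Sum>l<?e. smult (M0 $$ (a, l)) (?T (?G l u)))) +
        [:-c, 1:] * (\<Sum>l<?e. smult (M0 $$ (a, l)) (?T (?G l w)))))"
    using Suc.IH by (intro sum.cong arg_cong2[where f = smult] arg_cong2[where f = plus] arg_cong2[where f = times]) auto
  also have "\<dots> = (\<Sum>w<?e. \<Sum>l<?e. smult (M0 $$ (a, l)) (smult (sobol_F p $$ (w, v))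
      ((\<Sum>u<?e. smult (sobol_Q p $$ (u, w)) (?T (?G l u))) + [:-c, 1:] * ?T (?G l w))))"
  proof (rule sum.cong[OF refl], goal_cases)
    case (1 w)
    have "(\<Sum>u<?e. smult (sobol_Q p $$ (u, w)) (\<Sum>l<?e. smult (M0 $$ (a, l)) (?T (?G l u)))) =
       (\<Sum>l<?e. smult (M0 $$ (a, l)) (\<Sum>u<?e. smult (sobol_Q p $$ (u, w)) (?T (?G l u))))"
      unfolding smult_sum2 by (subst sum.swap) (simp add: mult.commute)
    then show ?case
      by (elim ssubst) (simp only: sum_distrib_left mult_smult_right smult_sum2 smult_add_right smult_smult
          sum.distrib mult_ac)
  qed
  also have "\<dots> = (\<Sum>l<?e. smult (M0 $$ (a, l)) (\<Sum>w<?e. smult (sobol_F p $$ (w, v))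
      ((\<Sum>u<?e. smult (sobol_Q p $$ (u, w)) (?T (?G l u))) + [:-c, 1:] * ?T (?G l w))))"
    by (subst sum.swap) (simp only: smult_sum2)
  \<comment> \<open>The inner sum is the recurrence of \<open>p\<close> itself after the
    substitution.\<close>
  also have "\<dots> = (\<Sum>l<?e. smult (M0 $$ (a, l)) (?T (sobol_poly p (1\<^sub>m ?e) (Suc j) l v)))"
    using Suc.prems
    by (intro sum.cong refl arg_cong2[where f = smult], subst sobol_poly_Suc[OF one])
      (simp_all only: lessThan_iff pcompose_sum pcompose_smult pcompose_add pcompose_mult pcompose_pCons, simp_all)
  finally show ?case .
qed

section \<open>Bases of the space of vector polynomials filtered by degree\<close>

text \<open>The coefficient of \<open>t^j\<close> in component \<open>u\<close> has position
  \<open>j * e + u\<close>, matching the row numbering of the Sobol' matrix. Only the first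
  \<open>m\<close> positions may be occupied, so this is a space of dimension
  \<open>m\<close>.\<close>

definition block_degree_less :: "nat \<Rightarrow> nat \<Rightarrow> (nat \<Rightarrow> 'a::zero poly) \<Rightarrow> bool" where
  "block_degree_less e m V \<longleftrightarrow> (\<forall>u<e. \<forall>j. m \<le> j * e + u \<longrightarrow> Polynomial.coeff (V u) j = 0)"

definition unitriangular_family :: "nat \<Rightarrow> (nat \<Rightarrow> nat \<Rightarrow> 'a::zero_neq_one poly) \<Rightarrow> bool" where
  "unitriangular_family e g \<longleftrightarrow> (\<forall>k. \<forall>u<e. \<forall>j.
     (k < j * e + u \<longrightarrow> Polynomial.coeff (g k u) j = 0) \<and> (k = j * e + u \<longrightarrow> Polynomial.coeff (g k u) j = 1))"

lemma block_degree_less_sum: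
  fixes g :: "nat \<Rightarrow> nat \<Rightarrow> 'a::field poly"
  assumes "unitriangular_family e g"
  shows "block_degree_less e m (\<lambda>u. \<Sum>k<m. smult (n k) (g k u))"
  using assms by (auto simp: block_degree_less_def unitriangular_family_def coeff_sum intro!: sum.neutral)

lemma unitriangular_family_coeff_top:
  fixes g :: "nat \<Rightarrow> nat \<Rightarrow> 'a::field poly"
  assumes "unitriangular_family e g" "e > 0"
  shows "Polynomial.coeff (g m (m mod e)) (m div e) = 1"
    and "k < m \<Longrightarrow> Polynomial.coeff (g k (m mod e)) (m div e) = 0"
proof -
  have "m mod e < e" "m div e * e + m mod e = m"
    using \<open>e > 0\<close> by auto
  then show "Polynomial.coeff (g m (m mod e)) (m div e) = 1"
      "k < m \<Longrightarrow> Polynomial.coeff (g k (m mod e)) (m div e) = 0"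
    using assms(1) unfolding unitriangular_family_def by metis+
qed

text \<open>Among the first \<open>m + 1\<close> members only \<open>g m\<close> has a nonzero
  coefficient at position \<open>m\<close>. Reading off that coefficient removes the last
  term.\<close>

lemma unitriangular_family_independent:
  fixes g :: "nat \<Rightarrow> nat \<Rightarrow> 'a::field poly"
  assumes g: "unitriangular_family e g" and e: "e > 0"
    and "\<And>u. u < e \<Longrightarrow> (\<Sum>k<m. smult (n k) (g k u)) = 0" and "k < m"
  shows "n k = 0"
  using assms(3-)
proof (induction m)
  case (Suc m)
  have "Polynomial.coeff (\<Sum>k<Suc m. smult (n k) (g k (m mod e))) (m div e) = n m"
    using unitriangular_family_coeff_top[OF g e] by (simp add: coeff_sum)
  then have "n m = 0"
    using Suc.prems(1)[of "m mod e"] e by (simp del: sum.lessThan_Suc)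
  then show ?case
    using Suc by (cases "k = m") auto
qed simp

text \<open>Elimination from the top: subtracting the multiple of \<open>g m\<close> given by the
  coefficient of \<open>V\<close> at position \<open>m\<close> leaves only lower positions.\<close>

lemma unitriangular_family_spans:
  fixes g :: "nat \<Rightarrow> nat \<Rightarrow> 'a::field poly"
  assumes g: "unitriangular_family e g" and e: "e > 0" and V: "block_degree_less e m V"
  shows "\<exists>n. \<forall>u<e. V u = (\<Sum>k<m. smult (n k) (g k u))"
  using V
proof (induction m arbitrary: V)
  case 0
  then have "V u = 0" if "u < e" for u
    using that by (intro poly_eqI) (auto simp: block_degree_less_def)
  then show ?case
    by simp
next
  case (Suc m)
  define a where "a = Polynomial.coeff (V (m mod e)) (m div e)"
  define W where "W u = V u - smult a (g m u)" for u
  have "Polynomial.coeff (W u) j = 0" if "u < e" "m \<le> j * e + u" for u j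
  proof (cases "m = j * e + u")
    case True
    then have "m mod e = u" "m div e = j"
      using that by auto
    then show ?thesis
      using unitriangular_family_coeff_top(1)[OF g e, of m] by (simp add: W_def a_def)
  next
    case False
    then show ?thesis
      using that g Suc.prems by (simp add: W_def block_degree_less_def unitriangular_family_def)
  qed
  then obtain n where n: "\<And>u. u < e \<Longrightarrow> W u = (\<Sum>k<m. smult (n k) (g k u))"
    using Suc.IH[of W] by (auto simp: block_degree_less_def)
  have "V u = (\<Sum>k<Suc m. smult ((n(m := a)) k) (g k u))" if "u < e" for u
  proof -
    have "(\<Sum>k<m. smult ((n(m := a)) k) (g k u)) = W u"
      unfolding n[OF that] by (intro sum.cong) auto
    then show ?thesis
      by (simp add: W_def)
  qed
  then show ?case
    by blast
qed

text \<open>The linear factor is monic, so the leading coefficient of each \<open>W u\<close>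
  reappears in \<open>V u\<close> one power higher, that is \<open>e\<close> positions later. For
  \<open>m < e\<close> the difference is truncated to 0, and the claim is that the components of
  \<open>W\<close> vanish.\<close>

lemma block_degree_less_quotient:
  fixes V W :: "nat \<Rightarrow> 'a::field poly"
  assumes V: "block_degree_less e m V" and W: "\<And>u. u < e \<Longrightarrow> V u = [:c, 1:] * W u"
  shows "block_degree_less e (m - e) W"
  unfolding block_degree_less_def
proof (intro allI impI)
  fix u j assume u: "u < e" and j: "m - e \<le> j * e + u"
  have "Polynomial.coeff (W u) l = 0" if "j \<le> l" for l
  proof (rule ccontr)
    assume nz: "Polynomial.coeff (W u) l \<noteq> 0"
    then have l: "l \<le> degree (W u)"
      by (rule le_degree)
    have "Polynomial.coeff (V u) (Suc (degree (W u))) = Polynomial.lead_coeff (W u)"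
      using u by (simp add: W coeff_eq_0)
    also have "\<dots> \<noteq> 0"
      using nz by auto
    finally have "Suc (degree (W u)) * e + u < m"
      using V u unfolding block_degree_less_def by (meson not_le)
    moreover have "j * e \<le> degree (W u) * e"
      using l that by (intro mult_right_mono) auto
    ultimately show False
      using j unfolding mult_Suc by linarith
  qed
  then show "Polynomial.coeff (W u) j = 0"
    by simp
qed

section \<open>Hermite interpolation of vector polynomials\<close>

text \<open>Composition with \<open>t - c\<close> turns Taylor coefficients at \<open>- c\<close>
  into ordinary coefficients. The formula is component \<open>r mod e\<close> of \<open>M0\<close>
  applied to the Taylor coefficient vector of order \<open>r div e\<close>.\<close>

definition taylor_row :: "nat \<Rightarrow> 'a::field mat \<Rightarrow> 'a \<Rightarrow> (nat \<Rightarrow> 'a poly) \<Rightarrow> nat \<Rightarrow> 'a" where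
  "taylor_row e M0 c V r =
     (\<Sum>u<e. M0 $$ (r mod e, u) * Polynomial.coeff (pcompose (V u) [:-c, 1:]) (r div e))"

text \<open>In the local coordinate at \<open>- c'\<close> the factor \<open>t + c\<close> becomes
  \<open>t + (c - c')\<close>: its constant scales each row, and its linear term shifts by one
  order, which is \<open>e\<close> rows.\<close>

lemma taylor_row_mult_linear:
  fixes V W :: "nat \<Rightarrow> 'a::field poly"
  assumes e: "e > 0" and W: "\<And>u. u < e \<Longrightarrow> V u = [:c, 1:] * W u"
  shows "taylor_row e M0 c' V r =
    (c - c') * taylor_row e M0 c' W r + (if e \<le> r then taylor_row e M0 c' W (r - e) else 0)"
proof -
  have comp: "pcompose (V u) [:-c', 1:] = [:c - c', 1:] * pcompose (W u) [:-c', 1:]" if "u < e" for u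
    using W[OF that] by (simp only: pcompose_mult) (simp add: pcompose_pCons)
  show ?thesis
  proof (cases "e \<le> r")
    case True
    then have "r mod e = (r - e) mod e" "r div e = Suc ((r - e) div e)"
      using e by (simp_all add: le_mod_geq le_div_geq)
    then show ?thesis
      using True by (simp add: taylor_row_def comp sum_distrib_left sum.distrib[symmetric] algebra_simps)
  next
    case False
    then have "r div e = 0"
      by simp
    then show ?thesis
      using False by (simp add: taylor_row_def comp sum_distrib_left coeff_pCons algebra_simps)
  qed
qed

lemma invertible_mat_kernel:
  fixes A :: "'a::field mat"
  assumes A: "A \<in> carrier_mat e e" and inv: "invertible_mat A"
    and zero: "\<And>r. r < e \<Longrightarrow> (\<Sum>u<e. A $$ (r, u) * x u) = 0" and "u < e"
  shows "x u = 0"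
proof -
  obtain B where B: "B * A = 1\<^sub>m (dim_row B)" and AB: "A * B = 1\<^sub>m e"
    using inv A by (auto simp: invertible_mat_def inverts_mat_def)
  have "dim_row B = e"
    using arg_cong[OF B, of dim_col] A by simp
  moreover have "dim_col B = e"
    using arg_cong[OF AB, of dim_col] by simp
  ultimately have Bc: "B \<in> carrier_mat e e"
    by auto
  have "A *\<^sub>v vec e x = 0\<^sub>v e"
    using A zero by (intro eq_vecI) (auto simp: scalar_prod_def atLeast0LessThan)
  moreover have "B *\<^sub>v 0\<^sub>v e = 0\<^sub>v e"
    using Bc by (intro eq_vecI) (auto simp: scalar_prod_def)
  ultimately have "B * A *\<^sub>v vec e x = 0\<^sub>v e"
    using A Bc by (simp add: assoc_mult_mat_vec[of _ e e _ e])
  then have "vec e x = 0\<^sub>v e"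
    using B \<open>dim_row B = e\<close> by simp
  then have "vec e x $ u = 0\<^sub>v e $ u"
    by simp
  then show ?thesis
    using \<open>u < e\<close> by simp
qed

text \<open>The number of conditions equals the dimension of the space of admissible
  \<open>V\<close>, so the homogeneous problem having only the zero solution expresses unique
  solvability.\<close>

definition taylor_unique ::
    "nat \<Rightarrow> nat \<Rightarrow> (nat \<Rightarrow> 'a::field mat) \<Rightarrow> (nat \<Rightarrow> 'a) \<Rightarrow> (nat \<Rightarrow> nat) \<Rightarrow> bool" where
  "taylor_unique e s M0 c d \<longleftrightarrow> (\<forall>V. block_degree_less e (sum d {..<s}) V \<longrightarrow>
     (\<forall>i<s. \<forall>r<d i. taylor_row e (M0 i) (c i) V r = 0) \<longrightarrow> (\<forall>u<e. V u = 0))"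

text \<open>The first \<open>e\<close> conditions at \<open>c i\<close> say that \<open>V\<close> vanishes at \<open>- c i\<close>. Dividing by the linear
  factor consumes these conditions, and at the other nodes it is invertible.\<close>

lemma taylor_unique_step:
  fixes M0 :: "nat \<Rightarrow> 'a::field mat"
  assumes e: "e > 0" and M0: "\<And>i. i < s \<Longrightarrow> M0 i \<in> carrier_mat e e" "\<And>i. i < s \<Longrightarrow> invertible_mat (M0 i)"
    and inj: "inj_on c {..<s}" and i: "i < s" and di: "e \<le> d i"
    and unique: "taylor_unique e s M0 c (d(i := d i - e))"
  shows "taylor_unique e s M0 c d"
  unfolding taylor_unique_def
proof (intro allI impI)
  let ?d = "d(i := d i - e)"
  fix V u
  assume V: "block_degree_less e (sum d {..<s}) V"
    and rows: "\<forall>i<s. \<forall>r<d i. taylor_row e (M0 i) (c i) V r = 0" and u: "u < e"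
  have sum: "sum ?d {..<s} = sum d {..<s} - e"
  proof -
    have "sum d {..<s} = d i + sum d ({..<s} - {i})"
      using i by (simp add: sum.remove)
    moreover have "sum ?d {..<s} = ?d i + sum ?d ({..<s} - {i})"
      using i by (intro sum.remove) auto
    moreover have "sum ?d ({..<s} - {i}) = sum d ({..<s} - {i})"
      by (intro sum.cong) auto
    ultimately show ?thesis
      using di by simp
  qed
  have "[:c i, 1:] dvd V u" if "u < e" for u
  proof -
    \<comment> \<open>As \<open>e \<le> d i\<close>, all rows of order 0 are available. They say
      that \<open>M0 i\<close> kills the vector of values at \<open>- c i\<close>, and
      \<open>M0 i\<close> is invertible.\<close>
    have "poly (V u) (- c i) = 0"
    proof (rule invertible_mat_kernel[OF M0(1,2)[OF i] _ that])
      fix r assume r: "r < e"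
      have const: "Polynomial.coeff (pcompose q [:- c i, 1:]) 0 = poly q (- c i)" for q
        by (simp add: poly_0_coeff_0[symmetric] poly_pcompose)
      then show "(\<Sum>u<e. M0 i $$ (r, u) * poly (V u) (- c i)) = 0"
        using rows[rule_format, OF i, of r] di r by (simp add: taylor_row_def const)
    qed
    then show ?thesis
      by (simp add: poly_eq_0_iff_dvd)
  qed
  then have "\<exists>W. \<forall>u<e. V u = [:c i, 1:] * W u"
    unfolding dvd_def by (intro choice) auto
  then obtain W where W: "\<And>u. u < e \<Longrightarrow> V u = [:c i, 1:] * W u"
    by blast
  have linear: "taylor_row e A c' V r =
      (c i - c') * taylor_row e A c' W r + (if e \<le> r then taylor_row e A c' W (r - e) else 0)" for A c' r
    using e W by (rule taylor_row_mult_linear)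
  have "taylor_row e (M0 l) (c l) W r = 0" if "l < s" "r < ?d l" for l r
  proof (cases "l = i")
    case True
    \<comment> \<open>At the node itself the scalar \<open>c i - c i\<close> is 0, so row
      \<open>r + e\<close> of \<open>V\<close> is row \<open>r\<close> of \<open>W\<close>.\<close>
    then show ?thesis
      using linear[of "M0 i" "c i" "r + e"] rows i that by auto
  next
    case False
    then have nz: "c i - c l \<noteq> 0"
      using inj that(1) i by (auto dest: inj_onD)
    \<comment> \<open>At another node the scalar is nonzero, so row \<open>r\<close> of
      \<open>W\<close> is determined by row \<open>r\<close> of \<open>V\<close> and row
      \<open>r - e\<close> of \<open>W\<close>, both zero.\<close>
    from that(2) show ?thesis
    proof (induction r rule: less_induct)
      case (less r)
      then show ?case
        using linear[of "M0 l" "c l" r] rows \<open>l < s\<close> nz False e by (auto split: if_splits)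
    qed
  qed
  moreover have "block_degree_less e (sum ?d {..<s}) W"
    unfolding sum using V W by (rule block_degree_less_quotient)
  ultimately have "W u = 0"
    using unique u unfolding taylor_unique_def by blast
  then show "V u = 0"
    using W[OF u] by simp
qed

lemma taylor_unique_if_small:
  fixes M0 :: "nat \<Rightarrow> 'a::field mat"
  assumes e: "e > 0" and M0: "\<And>i. i < s \<Longrightarrow> M0 i \<in> carrier_mat e e" "\<And>i. i < s \<Longrightarrow> invertible_mat (M0 i)"
    and inj: "inj_on c {..<s}"
    and small: "\<And>d. sum d {..<s} \<le> s * (e - 1) \<Longrightarrow> taylor_unique e s M0 c d"
  shows "taylor_unique e s M0 c d"
proof (induction "sum d {..<s}" arbitrary: d rule: less_induct)
  case less
  show ?case
  proof (cases "\<exists>i<s. e \<le> d i")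
    case True
    then obtain i where i: "i < s" "e \<le> d i"
      by blast
    have "sum (d(i := d i - e)) {..<s} < sum d {..<s}"
      using i e by (intro sum_strict_mono_ex1) auto
    then show ?thesis
      using taylor_unique_step[where i = i] e M0 inj i less by blast
  next
    case False
    \<comment> \<open>Nothing can be divided out any more. This is the source of the bound
      \<open>s * (e - 1)\<close>.\<close>
    then have "sum d {..<s} \<le> (\<Sum>i<s. e - 1)"
      by (intro sum_mono) (auto simp: not_le)
    then show ?thesis
      by (intro small) simp
  qed
qed

section \<open>From the Sobol' matrices to interpolation, and the conclusion\<close>

text \<open>Column \<open>k\<close> of the Sobol' matrix with identity initialization, read as a
  vector polynomial with components indexed by \<open>u\<close>.\<close>

definition sobol_basis :: "'a::field poly \<Rightarrow> nat \<Rightarrow> nat \<Rightarrow> 'a poly" where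
  "sobol_basis p k u = sobol_poly p (1\<^sub>m (degree p)) (k div degree p) u (k mod degree p)"

lemma unitriangular_family_sobol_basis:
  fixes p :: "'a::field poly"
  assumes e: "degree p > 0"
  shows "unitriangular_family (degree p) (sobol_basis p)"
  unfolding unitriangular_family_def
proof (intro allI impI)
  let ?e = "degree p" and ?I = "1\<^sub>m (degree p) :: 'a mat"
  fix k u j assume u: "u < ?e"
  have "Polynomial.coeff (sobol_basis p k u) j = sobol_matrix p ?I (j * ?e + u) k"
    using u e by (simp add: sobol_basis_def coeff_sobol_poly sobol_matrix_def)
  moreover have "sobol_matrix p ?I (j * ?e + u) (j * ?e + u) = 1"
    using u sobol_block_diagonal_one[OF u] by (simp add: sobol_matrix_def)
  moreover have "row_upper_triangular (sobol_matrix p ?I)"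
    using e by (intro row_upper_triangular_sobol_matrix) auto
  ultimately show "(k < j * ?e + u \<longrightarrow> Polynomial.coeff (sobol_basis p k u) j = 0) \<and>
      (k = j * ?e + u \<longrightarrow> Polynomial.coeff (sobol_basis p k u) j = 1)"
    by (auto simp: row_upper_triangular_def)
qed

text \<open>By \<open>sobol_poly_shift\<close> every column of the shifted matrix consists of the
  Taylor rows of the corresponding basis element. The rest is linearity in \<open>v\<close>.\<close>

lemma sobol_matrix_shift_row:
  fixes p :: "'a::field poly"
  assumes e: "degree p > 0" and M0: "M0 \<in> carrier_mat (degree p) (degree p)"
  shows "(\<Sum>k<m. sobol_matrix (p + [:c:]) M0 r k * v k) =
    taylor_row (degree p) M0 c (\<lambda>u. \<Sum>k<m. smult (v k) (sobol_basis p k u)) r"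
proof -
  let ?e = "degree p"
  have deg: "degree (p + [:c:]) = ?e"
    using e by (intro degree_add_eq_left) simp
  have "sobol_matrix (p + [:c:]) M0 r k =
      (\<Sum>u<?e. M0 $$ (r mod ?e, u) * Polynomial.coeff (pcompose (sobol_basis p k u) [:-c, 1:]) (r div ?e))" for k
  proof -
    have "sobol_matrix (p + [:c:]) M0 r k =
        Polynomial.coeff (sobol_poly (p + [:c:]) M0 (k div ?e) (r mod ?e) (k mod ?e)) (r div ?e)"
      using e M0 by (subst coeff_sobol_poly) (simp_all add: deg sobol_matrix_def)
    also have "\<dots> = (\<Sum>u<?e. M0 $$ (r mod ?e, u) *
        Polynomial.coeff (pcompose (sobol_basis p k u) [:-c, 1:]) (r div ?e))"
      using e M0 by (subst sobol_poly_shift) (simp_all add: coeff_sum sobol_basis_def)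
    finally show ?thesis .
  qed
  then have "(\<Sum>k<m. sobol_matrix (p + [:c:]) M0 r k * v k) = (\<Sum>k<m. \<Sum>u<?e. M0 $$ (r mod ?e, u) *
      (v k * Polynomial.coeff (pcompose (sobol_basis p k u) [:-c, 1:]) (r div ?e)))"
    by (simp add: sum_distrib_left mult_ac)
  also have "\<dots> = taylor_row ?e M0 c (\<lambda>u. \<Sum>k<m. smult (v k) (sobol_basis p k u)) r"
    by (subst sum.swap) (simp add: taylor_row_def pcompose_sum pcompose_smult coeff_sum sum_distrib_left)
  finally show ?thesis .
qed

text \<open>Since \<open>sobol_basis p\<close> is unitriangular, its first \<open>m\<close> members
  (\<open>m\<close> the sum of \<open>d\<close>) identify vectors of length \<open>m\<close> with
  the admissible vector polynomials. Under this identification the stacked matrix rows become the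
  Taylor conditions.\<close>

lemma nondegenerate_sobol_iff:
  fixes p :: "'a::field poly"
  assumes e: "degree p > 0" and M0: "\<And>i. i < s \<Longrightarrow> M0 i \<in> carrier_mat (degree p) (degree p)"
  shows "nondegenerate (\<lambda>i. sobol_matrix (p + [:c i:]) (M0 i)) s d \<longleftrightarrow> taylor_unique (degree p) s M0 c d"
proof -
  let ?e = "degree p" and ?m = "sum d {..<s}"
  note g = unitriangular_family_sobol_basis[OF e]
  define V where "V v u = (\<Sum>k<?m. smult (v k) (sobol_basis p k u))" for v u
  have row: "(\<Sum>k<?m. sobol_matrix (p + [:c i:]) (M0 i) r k * v k) = taylor_row ?e (M0 i) (c i) (V v) r"
    if "i < s" for i r v
    unfolding V_def using sobol_matrix_shift_row[OF e M0[OF that]] .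
  have zero: "(\<forall>u<?e. V v u = 0) \<longleftrightarrow> (\<forall>k<?m. v k = 0)" for v
    using unitriangular_family_independent[OF g e, where n = v and m = ?m] by (auto simp: V_def)
  show ?thesis
  proof
    assume nondeg: "nondegenerate (\<lambda>i. sobol_matrix (p + [:c i:]) (M0 i)) s d"
    show "taylor_unique ?e s M0 c d"
      unfolding taylor_unique_def
    proof (intro allI impI)
      fix X u
      assume X: "block_degree_less ?e ?m X" and u: "u < ?e"
        and rows: "\<forall>i<s. \<forall>r<d i. taylor_row ?e (M0 i) (c i) X r = 0"
      obtain v where v: "\<And>u. u < ?e \<Longrightarrow> X u = V v u"
        using unitriangular_family_spans[OF g e X] unfolding V_def by blast
      have "taylor_row ?e (M0 i) (c i) (V v) r = taylor_row ?e (M0 i) (c i) X r" for i r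
        unfolding taylor_row_def using v by (intro sum.cong) auto
      then show "X u = 0"
        using nondeg rows row zero[of v] u v unfolding nondegenerate_def by simp
    qed
  next
    assume unique: "taylor_unique ?e s M0 c d"
    show "nondegenerate (\<lambda>i. sobol_matrix (p + [:c i:]) (M0 i)) s d"
      unfolding nondegenerate_def
    proof (intro allI impI)
      fix v k
      assume "\<forall>i<s. \<forall>r<d i. (\<Sum>k<?m. sobol_matrix (p + [:c i:]) (M0 i) r k * v k) = 0" and k: "k < ?m"
      then have "\<forall>i<s. \<forall>r<d i. taylor_row ?e (M0 i) (c i) (V v) r = 0"
        by (simp add: row)
      moreover have "block_degree_less ?e ?m (V v)"
        unfolding V_def by (rule block_degree_less_sum[OF g])
      ultimately have "\<forall>u<?e. V v u = 0"
        using unique unfolding taylor_unique_def by blast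
      then show "v k = 0"
        using zero k by blast
    qed
  qed
qed

theorem theorem2:
  fixes p :: "'a::prime_card mod_ring poly"
    and c :: "nat \<Rightarrow> 'a mod_ring"
    and M0 :: "nat \<Rightarrow> 'a mod_ring mat"
    and x :: "nat \<Rightarrow> nat \<Rightarrow> real"
    and b e s :: nat
  assumes "b = CARD('a)"
    and "e \<ge> 1" and "s \<ge> 1"
    and "degree p = e"
    and "\<forall>i<s. irreducible (p + [:c i:]) \<and> degree (p + [:c i:]) = e"
    and "inj_on (\<lambda>i. p + [:c i:]) {..<s}"
    and "\<forall>i<s. M0 i \<in> carrier_mat e e \<and> invertible_mat (M0 i) \<and> upper_triangular (M0 i)"
    and "x = digital_seq (\<lambda>i. sobol_matrix (p + [:c i:]) (M0 i))"
    and "\<forall>m \<le> s * (e - 1). is_net b m s {..<b ^ m} x"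
  shows "is_zero_sequence b s x"
proof -
  let ?M = "\<lambda>i. sobol_matrix (p + [:c i:]) (M0 i)"
  have e: "degree p > 0" "e > 0"
    using assms(2,4) by auto
  have M0: "M0 i \<in> carrier_mat e e" "invertible_mat (M0 i)" "upper_triangular (M0 i)" if "i < s" for i
    using assms(7) that by blast+
  have upper: "row_upper_triangular (?M i)" if "i < s" for i
    using assms(5) e(2) M0[OF that] that by (intro row_upper_triangular_sobol_matrix) auto
  \<comment> \<open>Distinct shifted polynomials have distinct constants, so the interpolation nodes
    \<open>- c i\<close> are distinct.\<close>
  have inj: "inj_on c {..<s}"
    using assms(6) by (auto simp: inj_on_def)
  have iff: "nondegenerate ?M s d \<longleftrightarrow> taylor_unique e s M0 c d" for d
    using nondegenerate_sobol_iff[OF e(1), of s M0 c d] M0(1) assms(4) by blast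
  have small: "taylor_unique e s M0 c d" if "sum d {..<s} \<le> s * (e - 1)" for d
  proof -
    have "is_net CARD('a) (sum d {..<s}) s {..<CARD('a) ^ sum d {..<s}} (digital_seq ?M)"
      using assms(9) that unfolding assms(1,8) by simp
    with upper have "nondegenerate ?M s d"
      by (rule nondegenerate_if_is_net)
    then show ?thesis
      unfolding iff .
  qed
  have "taylor_unique e s M0 c d" for d
    by (rule taylor_unique_if_small[OF e(2) _ _ inj]) (fact M0(1) M0(2) small)+
  then have nondeg: "nondegenerate ?M s d" for d
    unfolding iff .
  show ?thesis
    unfolding is_zero_sequence_def assms(1,8)
    using is_net_if_nondegenerate[of s ?M, OF upper nondeg] by blast
qed

end
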